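(* Let $M=M_{\overline 0}\oplus M_{\overline 1}$ be an intermediate series module of $\mathfrak{L}$. Then $M$ is also an intermediate series module of the (centerless) Virasoro algebra; in other words, $I_k$, $G_k$, $H_k$ act trivially (as zero) on $M$ for all $k\in\mathbb{Z}$.
   Context: $\mathfrak{L}$ (the super $W(2,2)$ algebra) is the Lie superalgebra over $\mathbb{C}$ with basis $\{L_n,I_n,G_n,H_n\mid n\in\mathbb{Z}\}$, even part spanned by the $L_n,I_n$ and odd part spanned by the $G_n,H_n$, and with non-vanishing brackets (for $m,n\in\mathbb{Z}$) $[L_m,L_n]=(m-n)L_{m+n}$, $[L_m,I_n]=(m-n)I_{m+n}$, $[L_m,H_n]=(\frac{m}{2}-n)H_{m+n}$, $[G_m,G_n]=I_{m+n}$, $[L_m,G_n]=(\frac{m}{2}-n)G_{m+n}$, $[I_m,G_n]=(m-2n)H_{m+n}$; brackets of basis elements that do not follow from these by super-antisymmetry are zero. The centerless Virasoro algebra is $\mathrm{Span}_{\mathbb{C}}\{L_n\mid n\in\mathbb{Z}\}\subset\mathfrak{L}$. An intermediate series module of $\mathfrak{L}$ is an irreducible $\mathbb{Z}/2\mathbb{Z}$-graded $\mathfrak{L}$-module $M=M_{\overline 0}\oplus M_{\overline 1}$ such that, for $i=0,1$, $M_{\overline i}=\bigoplus_{\lambda\in\mathbb{C}}M_{\overline i}^{\lambda}$ with $M_{\overline i}^{\lambda}=\{x\in M_{\overline i}\mid L_0x=-\lambda x\}$ and $\dim M_{\overline i}^{\lambda}\le 1$ for all $\lambda\in\mathbb{C}$.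 An intermediate series module of the Virasoro algebra is an indecomposable module which is the direct sum of its $L_0$-eigenspaces, all of dimension at most $1$. *)

theory Defs
  imports Complex_Main "HOL-Library.Poly_Mapping" "HOL-Library.Z2"
begin

section \<open>Internal direct sums\<close>

text \<open>Meant for subspaces: existence says that \<open>V\<close> is the sum of the \<open>W j\<close>, uniqueness that the sum is
  direct.\<close>

definition internal_direct_sum :: "('j \<Rightarrow> 'v::comm_monoid_add set) \<Rightarrow> 'v set \<Rightarrow> bool" where
  "internal_direct_sum W V \<longleftrightarrow>
     (\<forall>j. W j \<subseteq> V) \<and>
     (\<forall>x\<in>V. \<exists>!f. (\<forall>j. f j \<in> W j) \<and> finite {j. f j \<noteq> 0} \<and> x = (\<Sum>j | f j \<noteq> 0. f j))"

section \<open>The super W(2,2) algebra\<close>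

datatype sW_basis = BL int | BI int | BG int | BH int

text \<open>The algebra is the free complex vector space on the basis, i.e. the finitely supported
  functions from the basis to the complex numbers.\<close>

type_synonym sW = "sW_basis \<Rightarrow>\<^sub>0 complex"

definition sW_scale :: "complex \<Rightarrow> sW \<Rightarrow> sW" where
  "sW_scale c = Poly_Mapping.map ((*) c)"

lemma lookup_sW_scale [simp]: "Poly_Mapping.lookup (sW_scale c x) b = c * Poly_Mapping.lookup x b"
  by (simp add: sW_scale_def Poly_Mapping.map.rep_eq when_def)

global_interpretation sW: vector_space sW_scale
  by unfold_locales (auto intro!: poly_mapping_eqI simp: lookup_add algebra_simps)

abbreviation Lgen :: "int \<Rightarrow> sW" where "Lgen n \<equiv> Poly_Mapping.single (BL n) 1"
abbreviation Igen :: "int \<Rightarrow> sW" where "Igen n \<equiv> Poly_Mapping.single (BI n) 1"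
abbreviation Ggen :: "int \<Rightarrow> sW" where "Ggen n \<equiv> Poly_Mapping.single (BG n) 1"
abbreviation Hgen :: "int \<Rightarrow> sW" where "Hgen n \<equiv> Poly_Mapping.single (BH n) 1"

text \<open>Parities are elements of the two-element field, 0 for even and 1 for odd.\<close>

fun parity_basis :: "sW_basis \<Rightarrow> bit" where
  "parity_basis (BL n) = 0"
| "parity_basis (BI n) = 0"
| "parity_basis (BG n) = 1"
| "parity_basis (BH n) = 1"

definition sW_part :: "bit \<Rightarrow> sW set" where
  "sW_part i = sW.span {Poly_Mapping.single b 1 | b. parity_basis b = i}"

definition super_sign :: "bit \<Rightarrow> bit \<Rightarrow> complex" where
  "super_sign i j = (if i = 1 \<and> j = 1 then -1 else 1)"

text \<open>The clauses with the arguments in the order (I,L), (H,L), (G,L), (G,I) are obtained from the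
  defining brackets by super-antisymmetry.\<close>

fun bracket_basis :: "sW_basis \<Rightarrow> sW_basis \<Rightarrow> sW" where
  "bracket_basis (BL m) (BL n) = sW_scale (of_int (m - n)) (Lgen (m + n))"
| "bracket_basis (BL m) (BI n) = sW_scale (of_int (m - n)) (Igen (m + n))"
| "bracket_basis (BL m) (BH n) = sW_scale (of_int m / 2 - of_int n) (Hgen (m + n))"
| "bracket_basis (BL m) (BG n) = sW_scale (of_int m / 2 - of_int n) (Ggen (m + n))"
| "bracket_basis (BG m) (BG n) = Igen (m + n)"
| "bracket_basis (BI m) (BG n) = sW_scale (of_int (m - 2 * n)) (Hgen (m + n))"
| "bracket_basis (BI m) (BL n) = sW_scale (- of_int (n - m)) (Igen (n + m))"
| "bracket_basis (BH m) (BL n) = sW_scale (- (of_int n / 2 - of_int m)) (Hgen (n + m))"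
| "bracket_basis (BG m) (BL n) = sW_scale (- (of_int n / 2 - of_int m)) (Ggen (n + m))"
| "bracket_basis (BG m) (BI n) = sW_scale (- of_int (n - 2 * m)) (Hgen (n + m))"
| "bracket_basis _ _ = 0"

definition bracket :: "sW \<Rightarrow> sW \<Rightarrow> sW" where
  "bracket x y = (\<Sum>a\<in>Poly_Mapping.keys x. \<Sum>b\<in>Poly_Mapping.keys y.
                    sW_scale (Poly_Mapping.lookup x a * Poly_Mapping.lookup y b) (bracket_basis a b))"

definition vir :: "sW set" where
  "vir = sW.span (range Lgen)"

subsection \<open>Lie superalgebra axioms\<close>

lemma bracket_superset:
  assumes "finite A" "Poly_Mapping.keys x \<subseteq> A" "finite B" "Poly_Mapping.keys y \<subseteq> B"
  shows "bracket x y = (\<Sum>a\<in>A. \<Sum>b\<in>B. sW_scale (Poly_Mapping.lookup x a * Poly_Mapping.lookup y b) (bracket_basis a b))"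
proof -
  have "bracket x y = (\<Sum>a\<in>Poly_Mapping.keys x. \<Sum>b\<in>B. sW_scale (Poly_Mapping.lookup x a * Poly_Mapping.lookup y b) (bracket_basis a b))"
    unfolding bracket_def
    by (intro sum.cong refl sum.mono_neutral_left) (use assms in \<open>auto simp: in_keys_iff\<close>)
  also have "\<dots> = (\<Sum>a\<in>A. \<Sum>b\<in>B. sW_scale (Poly_Mapping.lookup x a * Poly_Mapping.lookup y b) (bracket_basis a b))"
    by (intro sum.mono_neutral_left) (use assms in \<open>auto simp: in_keys_iff\<close>)
  finally show ?thesis .
qed

lemma bracket_single [simp]:
  "bracket (Poly_Mapping.single a 1) (Poly_Mapping.single b 1) = bracket_basis a b"
  by (simp add: bracket_def)

lemma linear_bracket_right: "Vector_Spaces.linear sW_scale sW_scale (bracket x)"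
proof unfold_locales
  fix y z :: sW and c :: complex
  let ?B = "Poly_Mapping.keys y \<union> Poly_Mapping.keys z"
  have yz: "Poly_Mapping.keys (y + z) \<subseteq> ?B" by (rule keys_add)
  show "bracket x (y + z) = bracket x y + bracket x z"
    using bracket_superset[OF finite_keys order_refl _ yz, of x]
      bracket_superset[of "Poly_Mapping.keys x" x ?B y] bracket_superset[of "Poly_Mapping.keys x" x ?B z]
    by (simp add: lookup_add ring_distribs sW.scale_left_distrib sum.distrib)
  have cy: "Poly_Mapping.keys (sW_scale c y) \<subseteq> Poly_Mapping.keys y" by (auto simp: in_keys_iff)
  show "bracket x (sW_scale c y) = sW_scale c (bracket x y)"
    using bracket_superset[OF finite_keys order_refl _ cy, of x]
    by (simp add: bracket_def sW.scale_sum_right mult_ac)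
qed

lemma linear_bracket_left: "Vector_Spaces.linear sW_scale sW_scale (\<lambda>x. bracket x y)"
proof unfold_locales
  fix x z :: sW and c :: complex
  let ?B = "Poly_Mapping.keys x \<union> Poly_Mapping.keys z"
  have xz: "Poly_Mapping.keys (x + z) \<subseteq> ?B" by (rule keys_add)
  show "bracket (x + z) y = bracket x y + bracket z y"
    using bracket_superset[OF _ xz finite_keys order_refl, of y]
      bracket_superset[of ?B x "Poly_Mapping.keys y" y] bracket_superset[of ?B z "Poly_Mapping.keys y" y]
    by (simp add: lookup_add ring_distribs sW.scale_left_distrib sum.distrib)
  have cx: "Poly_Mapping.keys (sW_scale c x) \<subseteq> Poly_Mapping.keys x" by (auto simp: in_keys_iff)
  show "bracket (sW_scale c x) y = sW_scale c (bracket x y)"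
    using bracket_superset[OF _ cx finite_keys order_refl, of y]
    by (simp add: bracket_def sW.scale_sum_right mult_ac)
qed

lemma bracket_scale_right [simp]: "bracket x (sW_scale c y) = sW_scale c (bracket x y)"
  by (rule module_hom.scale[OF Vector_Spaces.linear.axioms(3)[OF linear_bracket_right]])

lemma bracket_scale_left [simp]: "bracket (sW_scale c x) y = sW_scale c (bracket x y)"
  using module_hom.scale[OF Vector_Spaces.linear.axioms(3)[OF linear_bracket_left[of y]]] .

lemma bracket_add_right [simp]: "bracket x (y + z) = bracket x y + bracket x z"
  by (rule module_hom.add[OF Vector_Spaces.linear.axioms(3)[OF linear_bracket_right]])

lemma bracket_add_left [simp]: "bracket (x + z) y = bracket x y + bracket z y"
  using module_hom.add[OF Vector_Spaces.linear.axioms(3)[OF linear_bracket_left[of y]]] .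

lemma bracket_zero_left [simp]: "bracket 0 y = 0"
  and bracket_zero_right [simp]: "bracket x 0 = 0"
  by (simp_all add: bracket_def)

lemma sW_part_induct [consumes 1, case_names zero add scale basis]:
  assumes "x \<in> sW_part i" "P 0" "\<And>x y. P x \<Longrightarrow> P y \<Longrightarrow> P (x + y)"
    "\<And>c x. P x \<Longrightarrow> P (sW_scale c x)"
    "\<And>b. parity_basis b = i \<Longrightarrow> P (Poly_Mapping.single b 1)"
  shows "P x"
  using assms(1) unfolding sW_part_def
  by (rule sW.span_induct) (use assms(2-) in \<open>auto simp: sW.subspace_def\<close>)

lemma bracket_basis_antisym:
  "bracket_basis a b =
     sW_scale (- super_sign (parity_basis a) (parity_basis b)) (bracket_basis b a)"
  by (cases a; cases b)
     (auto simp: super_sign_def add.commute algebra_simps intro!: poly_mapping_eqI)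

lemma bracket_basis_jacobi:
  "bracket (Poly_Mapping.single a 1) (bracket_basis b c) =
     bracket (bracket_basis a b) (Poly_Mapping.single c 1) +
     sW_scale (super_sign (parity_basis a) (parity_basis b))
       (bracket (Poly_Mapping.single b 1) (bracket_basis a c))"
  by (cases a; cases b; cases c;
      auto simp: super_sign_def intro!: poly_mapping_eqI;
      simp add: lookup_add lookup_single when_def add_ac;
      (simp add: field_simps)?)

theorem bracket_antisym:
  assumes "x \<in> sW_part i" "y \<in> sW_part j"
  shows "bracket x y = sW_scale (- super_sign i j) (bracket y x)"
  using assms(1)
proof (induction rule: sW_part_induct)
  case (basis a)
  show ?case using assms(2)
  proof (induction rule: sW_part_induct)
    case (basis b)
    show ?case using bracket_basis_antisym[of a b] \<open>parity_basis a = i\<close> basis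
      by (simp only: bracket_single)
  qed (simp_all add: sW.scale_right_distrib mult_ac)
qed (simp_all add: sW.scale_right_distrib mult_ac)

theorem bracket_jacobi:
  assumes "x \<in> sW_part i" "y \<in> sW_part j" "z \<in> sW_part k"
  shows "bracket x (bracket y z) =
    bracket (bracket x y) z + sW_scale (super_sign i j) (bracket y (bracket x z))"
  using assms(1)
proof (induction rule: sW_part_induct)
  case (basis a)
  note a = basis
  show ?case using assms(2)
  proof (induction rule: sW_part_induct)
    case (basis b)
    note b = basis
    show ?case using assms(3)
    proof (induction rule: sW_part_induct)
      case (basis c)
      show ?case using bracket_basis_jacobi[of a b c] a b by (simp only: bracket_single)
    qed (simp_all add: sW.scale_right_distrib mult_ac)
  qed (simp_all add: sW.scale_right_distrib mult_ac)
qed (simp_all add: sW.scale_right_distrib mult_ac)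

section \<open>Modules\<close>

text \<open>The parameter \<open>M\<close> gives the even part \<open>M 0\<close> and the odd part \<open>M 1\<close> of the module.\<close>

locale sW_module = vector_space scale
  for scale :: "complex \<Rightarrow> 'v::ab_group_add \<Rightarrow> 'v" +
  fixes act :: "sW \<Rightarrow> 'v \<Rightarrow> 'v" and M :: "bit \<Rightarrow> 'v set"
  assumes subspace_part: "subspace (M i)"
    and grading: "internal_direct_sum M UNIV"
    and linear_act_left: "Vector_Spaces.linear sW_scale scale (\<lambda>x. act x v)"
    and linear_act_right: "Vector_Spaces.linear scale scale (act x)"
    and act_parity: "x \<in> sW_part i \<Longrightarrow> v \<in> M j \<Longrightarrow> act x v \<in> M (i + j)"
    and act_bracket: "x \<in> sW_part i \<Longrightarrow> y \<in> sW_part j \<Longrightarrow>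
      act (bracket x y) v = act x (act y v) - scale (super_sign i j) (act y (act x v))"
begin

definition graded_submodule :: "'v set \<Rightarrow> bool" where
  "graded_submodule N \<longleftrightarrow> subspace N \<and> (\<forall>x. \<forall>v\<in>N. act x v \<in> N) \<and>
     internal_direct_sum (\<lambda>i. N \<inter> M i) N"

definition irreducible_module :: bool where
  "irreducible_module \<longleftrightarrow> (UNIV :: 'v set) \<noteq> {0} \<and>
     (\<forall>N. graded_submodule N \<longrightarrow> N = {0} \<or> N = UNIV)"

definition weight_space :: "bit \<Rightarrow> complex \<Rightarrow> 'v set" where
  "weight_space i \<mu> = {v \<in> M i. act (Lgen 0) v = scale (- \<mu>) v}"

end

text \<open>Finite-dimensionality is required separately in the dimension bounds, because the library's
  \<open>dim\<close> is 0 on infinite-dimensional spaces.\<close>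

locale sW_intermediate_series = sW_module scale act M
  for scale :: "complex \<Rightarrow> 'v::ab_group_add \<Rightarrow> 'v" and act M +
  assumes irreducible_module: irreducible_module
    and weight_decomposition: "internal_direct_sum (weight_space i) (M i)"
    and finite_dim_weight_space: "\<exists>B. finite B \<and> span B = weight_space i \<mu>"
    and dim_weight_space_le: "dim (weight_space i \<mu>) \<le> 1"

text \<open>A module over the Virasoro subalgebra: only the values of \<open>act\<close> on \<open>vir\<close> matter.\<close>

locale vir_module = vector_space scale
  for scale :: "complex \<Rightarrow> 'v::ab_group_add \<Rightarrow> 'v" +
  fixes act :: "sW \<Rightarrow> 'v \<Rightarrow> 'v"
  assumes vir_act_add: "x \<in> vir \<Longrightarrow> y \<in> vir \<Longrightarrow> act (x + y) v = act x v + act y v"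
    and vir_act_scale: "x \<in> vir \<Longrightarrow> act (sW_scale c x) v = scale c (act x v)"
    and vir_linear_act: "x \<in> vir \<Longrightarrow> Vector_Spaces.linear scale scale (act x)"
    and vir_act_bracket: "x \<in> vir \<Longrightarrow> y \<in> vir \<Longrightarrow>
      act (bracket x y) v = act x (act y v) - act y (act x v)"
begin

definition vir_submodule :: "'v set \<Rightarrow> bool" where
  "vir_submodule N \<longleftrightarrow> subspace N \<and> (\<forall>x\<in>vir. \<forall>v\<in>N. act x v \<in> N)"

definition indecomposable :: bool where
  "indecomposable \<longleftrightarrow> (UNIV :: 'v set) \<noteq> {0} \<and>
     \<not> (\<exists>U W. vir_submodule U \<and> vir_submodule W \<and> U \<noteq> {0} \<and> W \<noteq> {0} \<and>
            U \<inter> W = {0} \<and> {u + w | u w. u \<in> U \<and> w \<in> W} = UNIV)"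

definition eigenspace :: "complex \<Rightarrow> 'v set" where
  "eigenspace \<mu> = {v. act (Lgen 0) v = scale \<mu> v}"

end

locale vir_intermediate_series = vir_module scale act
  for scale :: "complex \<Rightarrow> 'v::ab_group_add \<Rightarrow> 'v" and act +
  assumes indecomposable: indecomposable
    and eigenspace_decomposition: "internal_direct_sum eigenspace UNIV"
    and finite_dim_eigenspace: "\<exists>B. finite B \<and> span B = eigenspace \<mu>"
    and dim_eigenspace_le: "dim (eigenspace \<mu>) \<le> 1"

end

theory Submission
  imports Defs
begin

text \<open>If \<open>v\<close> has weight \<open>\<mu>\<close> and \<open>m \<noteq> 0\<close>, then \<open>I\<^sub>0\<close> acts on the homogeneous line through \<open>v\<close> by a scalar,
  and as \<open>I\<^sub>0\<close> commutes with \<open>I\<^sub>m\<close> it acts by the same scalar on the line containing \<open>I\<^sub>m v\<close> (unless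
  \<open>I\<^sub>m v = 0\<close>) and \<open>L\<^sub>m v\<close>; hence \<open>m I\<^sub>m v = [L\<^sub>m, I\<^sub>0] v = 0\<close>. So \<open>I\<^sub>k = 0\<close> for \<open>k \<noteq> 0\<close>, which forces
  \<open>I\<^sub>0 = [L\<^sub>1, I\<^sub>-\<^sub>1]/2 = 0\<close> and \<open>H\<^sub>k = 0\<close>, and the \<open>G\<^sub>k\<close> anticommute. The operator \<open>G\<^sub>a G\<^sub>-\<^sub>a\<close> acts on a line and
  squares to zero, so it vanishes. Bracketing with \<open>L\<^sub>1\<close> and \<open>L\<^sub>-\<^sub>1\<close> shows that \<open>G\<^sub>0 G\<^sub>1\<close> and \<open>G\<^sub>0 G\<^sub>-\<^sub>1\<close> are killed
  by all \<open>G\<^sub>a\<close>. The common kernel of the \<open>G\<^sub>a\<close> is a graded submodule; if it is \<open>0\<close>, then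
  \<open>G\<^sub>0 G\<^sub>1 = G\<^sub>0 G\<^sub>-\<^sub>1 = 0\<close>, and bracketing these and \<open>G\<^sub>1 G\<^sub>-\<^sub>1 = 0\<close> with suitable \<open>L\<^sub>m\<close> gives \<open>12 G\<^sub>0 G\<^sub>n = 0\<close>
  for all \<open>n\<close>, so that \<open>G\<^sub>0\<close> maps into the kernel and \<open>G\<^sub>0 = 0\<close>, whence all \<open>G\<^sub>n = 0\<close>.
  Once only the \<open>L\<^sub>n\<close> act nontrivially, both parities are submodules, so \<open>M\<close> is concentrated in one of
  them and is irreducible over the Virasoro algebra.\<close>

section \<open>Direct sums, one-dimensional spaces and the two parities\<close>

lemma internal_direct_sum_reindex:
  assumes "bij h" and W: "internal_direct_sum W V"
  shows "internal_direct_sum (\<lambda>j. W (h j)) V"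
  unfolding internal_direct_sum_def
proof (intro conjI allI ballI)
  show "W (h j) \<subseteq> V" for j
    using W by (auto simp: internal_direct_sum_def)
next
  fix x assume "x \<in> V"
  with W have ex1: "\<exists>!f. (\<forall>j. f j \<in> W j) \<and> finite {j. f j \<noteq> 0} \<and> x = (\<Sum>j | f j \<noteq> 0. f j)"
    by (auto simp: internal_direct_sum_def)
  have h [simp]: "h (inv h j) = j" "inv h (h i) = i" for i j
    using \<open>bij h\<close> by (simp_all add: bij_is_surj surj_f_inv_f bij_is_inj)
  have bij_supp: "bij_betw h {j. f (h j) \<noteq> 0} {j. f j \<noteq> 0}" for f :: "'b \<Rightarrow> 'c"
    by (rule bij_betw_byWitness[where f' = "inv h"]) auto
  \<comment> \<open>Composing with \<open>h\<close> matches supports bijectively and preserves the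
    sum, so decompositions over the two index sets correspond.\<close>
  have iff: "(\<forall>j. f (h j) \<in> W (h j)) \<and> finite {j. f (h j) \<noteq> 0} \<and> x = (\<Sum>j | f (h j) \<noteq> 0. f (h j)) \<longleftrightarrow>
      (\<forall>j. f j \<in> W j) \<and> finite {j. f j \<noteq> 0} \<and> x = (\<Sum>j | f j \<noteq> 0. f j)" for f :: "'b \<Rightarrow> 'c"
    using bij_betw_finite[OF bij_supp, of f] sum.reindex_bij_betw[OF bij_supp, of f f]
    by (metis h(1))
  from ex1 obtain f where f: "(\<forall>j. f j \<in> W j) \<and> finite {j. f j \<noteq> 0} \<and> x = (\<Sum>j | f j \<noteq> 0. f j)"
    and uniq: "\<And>g. (\<forall>j. g j \<in> W j) \<and> finite {j. g j \<noteq> 0} \<and> x = (\<Sum>j | g j \<noteq> 0. g j) \<Longrightarrow> g = f"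
    by metis
  show "\<exists>!f. (\<forall>j. f j \<in> W (h j)) \<and> finite {j. f j \<noteq> 0} \<and> x = (\<Sum>j | f j \<noteq> 0. f j)"
  proof (rule ex1I[of _ "\<lambda>j. f (h j)"])
    show "(\<forall>j. f (h j) \<in> W (h j)) \<and> finite {j. f (h j) \<noteq> 0} \<and> x = (\<Sum>j | f (h j) \<noteq> 0. f (h j))"
      using f iff[of f] by blast
    fix g assume g: "(\<forall>j. g j \<in> W (h j)) \<and> finite {j. g j \<noteq> 0} \<and> x = (\<Sum>j | g j \<noteq> 0. g j)"
    have "(\<lambda>j. g (inv h j)) = f"
      using iff[of "\<lambda>j. g (inv h j)"] g by (intro uniq) simp
    then show "g = (\<lambda>j. f (h j))" by auto
  qed
qed

lemma (in vector_space) internal_direct_sum_subset: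
  assumes "internal_direct_sum W V" "subspace S" "\<And>j. W j \<subseteq> S"
  shows "V \<subseteq> S"
proof
  fix x assume "x \<in> V"
  then obtain f where "\<forall>j. f j \<in> W j" "x = (\<Sum>j | f j \<noteq> 0. f j)"
    using assms(1) by (auto simp: internal_direct_sum_def)
  then show "x \<in> S"
    using assms(2,3) by (auto intro!: subspace_sum)
qed

text \<open>Two independent vectors would exceed the dimension bound. The finite spanning set
  \<open>B\<close> makes the basis \<open>C\<close> finite, so that cardinalities can be
  compared.\<close>

lemma (in vector_space) line_scale_exists:
  assumes "finite B" "span B = S" "dim S \<le> 1" "v \<in> S" "v \<noteq> 0" "w \<in> S"
  shows "\<exists>c. w = scale c v"
proof (rule ccontr)
  assume not: "\<nexists>c. w = scale c v"
  then have "w \<notin> span {v}" by (auto simp: span_singleton)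
  then have indep: "independent {w, v}"
    using \<open>v \<noteq> 0\<close> by (simp add: independent_insert dependent_single)
  have "w \<noteq> v" using not by (metis scale_one)
  obtain C where C: "C \<subseteq> S" "independent C" "S \<subseteq> span C" "card C = dim S"
    using basis_exists by blast
  have "finite C" using independent_span_bound[of B C] C assms by auto
  then have "card {w, v} \<le> card C"
    using independent_span_bound[of C "{w, v}"] indep C assms by auto
  with \<open>w \<noteq> v\<close> C(4) assms(3) show False by simp
qed

lemma sum_support_bit:
  fixes f :: "bit \<Rightarrow> 'a::comm_monoid_add"
  shows "(\<Sum>j | f j \<noteq> 0. f j) = f 0 + f 1"
proof -
  have U: "(UNIV :: bit set) = {0, 1}" by (auto intro: bit.exhaust)
  have "(\<Sum>j | f j \<noteq> 0. f j) = (\<Sum>j\<in>UNIV. f j)"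
    by (rule sum.mono_neutral_left) (auto simp: U)
  also have "\<dots> = f 0 + f 1" by (simp add: U)
  finally show ?thesis .
qed

lemma finite_bit_set: "finite (A :: bit set)"
proof -
  have "A \<subseteq> {0, 1}" by (auto intro: bit.exhaust)
  then show ?thesis by (rule finite_subset) simp
qed

lemma single_in_sW_part: "Poly_Mapping.single b 1 \<in> sW_part (parity_basis b)"
  unfolding sW_part_def by (auto intro: sW.span_base)

text \<open>Oddness allows the factors in the recursion of \<open>G_G_sign\<close> to be cancelled
  at every integer.\<close>

lemma of_int_odd_nonzero: "1 - 2 * of_int k \<noteq> (0 :: complex)"
proof
  assume "1 - 2 * of_int k = (0 :: complex)"
  then have "of_int (1 - 2 * k) = (0 :: complex)" by simp
  then have "1 - 2 * k = 0" unfolding of_int_eq_0_iff .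
  then show False by presburger
qed

section \<open>Modules over the super W(2,2) algebra\<close>

context sW_module
begin

section \<open>The brackets as operator relations\<close>

abbreviation "L n \<equiv> act (Lgen n)"
abbreviation "I n \<equiv> act (Igen n)"
abbreviation "G n \<equiv> act (Ggen n)"
abbreviation "H n \<equiv> act (Hgen n)"

lemma act_add_right [simp]: "act x (u + v) = act x u + act x v"
  by (rule module_hom.add[OF Vector_Spaces.linear.axioms(3)[OF linear_act_right]])

lemma act_scale_right [simp]: "act x (scale c v) = scale c (act x v)"
  by (rule module_hom.scale[OF Vector_Spaces.linear.axioms(3)[OF linear_act_right]])

lemma act_zero_right [simp]: "act x 0 = 0"
  by (rule module_hom.zero[OF Vector_Spaces.linear.axioms(3)[OF linear_act_right]])

lemma act_minus_right [simp]: "act x (- v) = - act x v"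
  by (rule module_hom.neg[OF Vector_Spaces.linear.axioms(3)[OF linear_act_right]])

lemma act_add_left [simp]: "act (x + y) v = act x v + act y v"
  using module_hom.add[OF Vector_Spaces.linear.axioms(3)[OF linear_act_left[of v]]] .

lemma act_scale_left [simp]: "act (sW_scale c x) v = scale c (act x v)"
  using module_hom.scale[OF Vector_Spaces.linear.axioms(3)[OF linear_act_left[of v]]] .

lemma act_diff_left [simp]: "act (x - y) v = act x v - act y v"
  using module_hom.diff[OF Vector_Spaces.linear.axioms(3)[OF linear_act_left[of v]]] .

lemma act_zero_left [simp]: "act 0 v = 0"
  using module_hom.zero[OF Vector_Spaces.linear.axioms(3)[OF linear_act_left[of v]]] .

lemma act_bracket_basis:
  "act (bracket_basis a b) v =
     act (Poly_Mapping.single a 1) (act (Poly_Mapping.single b 1) v) -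
     scale (super_sign (parity_basis a) (parity_basis b))
       (act (Poly_Mapping.single b 1) (act (Poly_Mapping.single a 1) v))"
  using act_bracket[OF single_in_sW_part[of a] single_in_sW_part[of b]] by simp

lemma L_L: "L m (L n v) = L n (L m v) + scale (of_int (m - n)) (L (m + n) v)"
  using act_bracket_basis[of "BL m" "BL n" v] by (simp add: super_sign_def algebra_simps)

lemma L_I: "L m (I n v) = I n (L m v) + scale (of_int (m - n)) (I (m + n) v)"
  using act_bracket_basis[of "BL m" "BI n" v] by (simp add: super_sign_def algebra_simps)

lemma L_G: "L m (G n v) = G n (L m v) + scale (of_int m / 2 - of_int n) (G (m + n) v)"
  using act_bracket_basis[of "BL m" "BG n" v] by (simp add: super_sign_def algebra_simps)

lemma I_I: "I m (I n v) = I n (I m v)"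
  using act_bracket_basis[of "BI m" "BI n" v] by (simp add: super_sign_def)

lemma I_G: "I m (G n v) = G n (I m v) + scale (of_int (m - 2 * n)) (H (m + n) v)"
  using act_bracket_basis[of "BI m" "BG n" v] by (simp add: super_sign_def algebra_simps)

lemma G_G: "G m (G n v) + G n (G m v) = I (m + n) v"
  using act_bracket_basis[of "BG m" "BG n" v] by (simp add: super_sign_def)

lemma act_parity_basis:
  "v \<in> M j \<Longrightarrow> act (Poly_Mapping.single b 1) v \<in> M (parity_basis b + j)"
  by (rule act_parity[OF single_in_sW_part])

lemma act_closed_basis:
  assumes "subspace N" "\<And>b. act (Poly_Mapping.single b 1) v \<in> N"
  shows "act x v \<in> N"
proof (induction x rule: update_induct)
  case const
  show ?case using assms(1) by (simp add: subspace_0)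
next
  case (update x b c)
  have "Poly_Mapping.update b c x = x + sW_scale c (Poly_Mapping.single b 1)"
    by (rule poly_mapping_eqI)
      (use update.hyps in \<open>auto simp: lookup_update lookup_add lookup_single when_def in_keys_iff\<close>)
  then show ?case using assms update.IH by (simp add: subspace_add subspace_scale)
qed

section \<open>Parity components and graded submodules\<close>

lemma parity_unique_decomposition: "\<exists>!f. (\<forall>j. f j \<in> M j) \<and> v = f 0 + f 1"
  using grading by (simp add: internal_direct_sum_def sum_support_bit finite_bit_set)

lemma parity_decomposition_unique:
  assumes f: "\<And>j. f j \<in> M j" and g: "\<And>j. g j \<in> M j" and eq: "f 0 + f 1 = g 0 + g 1"
  shows "f = g"
proof -
  obtain h where "\<And>k. (\<forall>j. k j \<in> M j) \<and> f 0 + f 1 = k 0 + k 1 \<Longrightarrow> k = h"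
    using parity_unique_decomposition[of "f 0 + f 1"] unfolding Ex1_def by blast
  then have "f = h" "g = h" using f g eq by blast+
  then show ?thesis by simp
qed

lemma parity_decomposition:
  obtains u w where "u \<in> M 0" "w \<in> M 1" "v = u + w"
  using ex1_implies_ex[OF parity_unique_decomposition[of v]] that by blast

lemma parity_independent:
  assumes "u \<in> M 0" "w \<in> M 1" "u + w = 0"
  shows "u = 0" "w = 0"
proof -
  define f where "f = (\<lambda>j::bit. if j = 0 then u else w)"
  have "f = (\<lambda>_. 0)"
    by (rule parity_decomposition_unique) (use assms subspace_part in \<open>auto simp: f_def subspace_0\<close>)
  then show "u = 0" "w = 0" by (auto simp: f_def fun_eq_iff split: if_splits)
qed

lemma parts_disjoint:
  assumes "v \<in> M 0" "v \<in> M 1" shows "v = 0"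
  using parity_independent[of v "- v"] assms subspace_neg[OF subspace_part] by auto

text \<open>The last hypothesis puts the parity components of a vector of \<open>N\<close> back into
  \<open>N\<close>; their uniqueness is inherited from the grading of the whole module.\<close>

lemma graded_submoduleI:
  assumes N: "subspace N" and closed: "\<And>b v. v \<in> N \<Longrightarrow> act (Poly_Mapping.single b 1) v \<in> N"
    and comp: "\<And>u w. u \<in> M 0 \<Longrightarrow> w \<in> M 1 \<Longrightarrow> u + w \<in> N \<Longrightarrow> u \<in> N \<and> w \<in> N"
  shows "graded_submodule N"
  unfolding graded_submodule_def
proof (intro conjI allI ballI)
  show "subspace N" by (rule N)
  show "act x v \<in> N" if "v \<in> N" for x v
    using act_closed_basis[OF N closed] that by blast
  show "internal_direct_sum (\<lambda>i. N \<inter> M i) N"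
    unfolding internal_direct_sum_def
  proof (intro conjI allI ballI)
    fix v assume "v \<in> N"
    obtain f where f: "\<forall>j. f j \<in> M j" "v = f 0 + f 1"
      using ex1_implies_ex[OF parity_unique_decomposition[of v]] by blast
    with \<open>v \<in> N\<close> comp have "f 0 \<in> N \<and> f 1 \<in> N" by blast
    then have "f j \<in> N" for j by (cases j) auto
    show "\<exists>!f. (\<forall>j. f j \<in> N \<inter> M j) \<and> finite {j. f j \<noteq> 0} \<and> v = (\<Sum>j | f j \<noteq> 0. f j)"
      unfolding sum_support_bit
    proof (rule ex1I[of _ f])
      show "(\<forall>j. f j \<in> N \<inter> M j) \<and> finite {j. f j \<noteq> 0} \<and> v = f 0 + f 1"
        using f \<open>\<And>j. f j \<in> N\<close> finite_bit_set by auto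
      fix g assume "(\<forall>j. g j \<in> N \<inter> M j) \<and> finite {j. g j \<noteq> 0} \<and> v = g 0 + g 1"
      then have g: "(\<forall>j. g j \<in> M j) \<and> v = g 0 + g 1" by auto
      show "g = f"
        by (rule parity_decomposition_unique) (use f g in auto)
    qed
  qed auto
qed

text \<open>Each generator X_m satisfies [L_0, X_m] = -m X_m, and weight \<mu> means eigenvalue
  \<open>- \<mu>\<close>, so the weight rises by \<open>m\<close>.\<close>

lemma L_weight: "v \<in> weight_space i \<mu> \<Longrightarrow> L m v \<in> weight_space i (\<mu> + of_int m)"
  using act_parity_basis[of v i "BL m"] L_L[of 0 m v]
  by (cases i) (simp_all add: weight_space_def algebra_simps)

lemma I_weight: "v \<in> weight_space i \<mu> \<Longrightarrow> I m v \<in> weight_space i (\<mu> + of_int m)"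
  using act_parity_basis[of v i "BI m"] L_I[of 0 m v]
  by (cases i) (simp_all add: weight_space_def algebra_simps)

lemma G_weight: "v \<in> weight_space i \<mu> \<Longrightarrow> G m v \<in> weight_space (1 + i) (\<mu> + of_int m)"
  using act_parity_basis[of v i "BG m"] L_G[of 0 m v]
  by (simp add: weight_space_def algebra_simps)

end

section \<open>Intermediate series modules\<close>

context sW_intermediate_series
begin

text \<open>Applied to kernels of operators, this extends vanishing from weight vectors to all
  vectors.\<close>

lemma weight_spaces_generate:
  assumes S: "subspace S" "\<And>i \<mu>. weight_space i \<mu> \<subseteq> S"
  shows "v \<in> S"
proof -
  have "M i \<subseteq> S" for i
    by (rule internal_direct_sum_subset[OF weight_decomposition S])
  from internal_direct_sum_subset[OF grading S(1) this] show ?thesis by blast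
qed

lemma weight_space_line:
  assumes "v \<in> weight_space i \<mu>" "v \<noteq> 0" "w \<in> weight_space i \<mu>"
  obtains c where "w = scale c v"
proof -
  obtain B where "finite B" "span B = weight_space i \<mu>"
    using finite_dim_weight_space by blast
  from line_scale_exists[OF this dim_weight_space_le assms] that show thesis by blast
qed

section \<open>Vanishing of the I and H operators\<close>

lemma I_weight_eq_0:
  assumes v: "v \<in> weight_space i \<mu>" and "m \<noteq> 0"
  shows "I m v = 0"
proof (rule ccontr)
  assume nz: "I m v \<noteq> 0"
  then have "v \<noteq> 0" by auto
  have "I 0 v \<in> weight_space i \<mu>" using I_weight[OF v, of 0] by simp
  then obtain c where c: "I 0 v = scale c v"
    using weight_space_line[OF v \<open>v \<noteq> 0\<close>] by blast
  obtain d where d: "L m v = scale d (I m v)"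
    using weight_space_line[OF I_weight[OF v] nz L_weight[OF v]] by blast
  \<comment> \<open>\<open>L m v\<close> is a multiple of \<open>I m v\<close>, on which
    \<open>I 0\<close> acts by \<open>c\<close> because it commutes with \<open>I m\<close>.\<close>
  have "I 0 (L m v) = scale c (L m v)"
    by (simp add: d I_I[of 0] c scale_left_commute)
  with L_I[of m 0 v] c have "scale (of_int m) (I m v) = 0" by simp
  with nz \<open>m \<noteq> 0\<close> show False by simp
qed

lemma I_eq_0: "I m v = 0"
proof -
  have nz: "I k w = 0" if "k \<noteq> 0" for k w
  proof -
    have weight: "weight_space i \<mu> \<subseteq> {w. I k w = 0}" for i \<mu>
      using I_weight_eq_0[OF _ that] by blast
    have "subspace {w. I k w = 0}" by (simp add: subspace_def)
    from weight_spaces_generate[OF this weight, of w] show ?thesis by simp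
  qed
  show ?thesis
  proof (cases "m = 0")
    case True
    show ?thesis using L_I[of 1 "-1" v] by (simp add: nz True)
  qed (rule nz)
qed

text \<open>[I_m, G_0] = m H_m settles \<open>m \<noteq> 0\<close>; for H_0 the indices -1 and 1
  give the nonzero coefficient -3.\<close>

lemma H_eq_0: "H m v = 0"
proof (cases "m = 0")
  case True
  show ?thesis using I_G[of "-1" 1 v] by (simp add: I_eq_0 True)
next
  case False
  then show ?thesis using I_G[of m 0 v] by (simp add: I_eq_0)
qed

section \<open>Products of two G operators\<close>

lemma G_anticommute: "G a (G b v) = - G b (G a v)"
  using G_G[of a b v] by (simp add: I_eq_0 eq_neg_iff_add_eq_0)

lemma G_square [simp]: "G a (G a v) = 0"
proof -
  have "scale 2 (G a (G a v)) = G a (G a v) + G a (G a v)"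
    using scale_left_distrib[of 1 1] by simp
  also have "\<dots> = 0" by (simp add: G_G I_eq_0)
  finally show ?thesis by simp
qed

lemma G_G_uminus [simp]: "G a (G (- a) v) = 0"
proof -
  have "G a (G (- a) w) = 0" if w: "w \<in> weight_space i \<mu>" for w i \<mu>
  proof (cases "w = 0")
    case False
    have "G a (G (- a) w) \<in> weight_space i \<mu>"
      using G_weight[OF G_weight[OF w, of "-a"], of a] by (cases i) simp_all
    then obtain c where c: "G a (G (- a) w) = scale c w"
      using weight_space_line[OF w False] by blast
    \<comment> \<open>Anticommuting brings two copies of \<open>G (- a)\<close> together, which
      forces c^2 w = 0.\<close>
    have "scale c (scale c w) = G a (G (- a) (G a (G (- a) w)))"
      by (simp only: c act_scale_right)
    also have "G (- a) (G a (G (- a) w)) = - G a (G (- a) (G (- a) w))"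
      by (rule G_anticommute)
    also have "G (- a) (G (- a) w) = 0" by (rule G_square)
    finally have "scale c (scale c w) = 0" by simp
    then show ?thesis using False c by simp
  qed simp
  then have weight: "weight_space i \<mu> \<subseteq> {w. G a (G (- a) w) = 0}" for i \<mu> by blast
  have "subspace {w. G a (G (- a) w) = 0}" by (simp add: subspace_def)
  from weight_spaces_generate[OF this weight, of v] show ?thesis by simp
qed

lemma L_G_G:
  "L k (G a (G b v)) = G a (G b (L k v)) + scale (of_int k / 2 - of_int a) (G (k + a) (G b v)) +
     scale (of_int k / 2 - of_int b) (G a (G (k + b) v))"
proof -
  have "L k (G a (G b v)) = G a (L k (G b v)) + scale (of_int k / 2 - of_int a) (G (k + a) (G b v))"
    by (rule L_G)
  also have "L k (G b v) = G b (L k v) + scale (of_int k / 2 - of_int b) (G (k + b) v)"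
    by (rule L_G)
  finally show ?thesis by (simp only: act_add_right act_scale_right add.assoc add.commute add.left_commute)
qed

text \<open>Commuting L_k with a product that vanishes on every vector, including
  \<open>L k v\<close>, leaves a linear relation between products of total index k + a + b.\<close>

lemma G_G_zero_bracket:
  assumes "\<And>v. G a (G b v) = 0"
  shows "scale (of_int k / 2 - of_int a) (G (k + a) (G b v)) +
     scale (of_int k / 2 - of_int b) (G a (G (k + b) v)) = 0"
  using L_G_G[of k a b v] unfolding assms by (simp only: act_zero_right add_0_left)

text \<open>The sign \<open>s\<close> treats total indices 1 and -1 together. Bracketing
  \<open>G (s * k) (G (- (s * k)) v) = 0\<close> with L_s relates neighbouring values of
  \<open>k\<close>, and the recursion is solved from \<open>k = 0\<close> in both
  directions.\<close>

lemma G_G_sign: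
  assumes s: "s = 1 \<or> s = -1"
  shows "G (s * k) (G (s - s * k) v) = scale (1 - 2 * of_int k) (G 0 (G s v))"
proof -
  define F where "F k = G (s * k) (G (s - s * k) v)" for k
  have step: "scale (1 - 2 * of_int k) (F (k + 1)) = scale (- (1 + 2 * of_int k)) (F k)" for k
  proof -
    have "scale (of_int s / 2 - of_int (s * k)) (F (k + 1)) +
        scale (of_int s / 2 + of_int (s * k)) (F k) = 0"
      using G_G_zero_bracket[OF G_G_uminus, of s "s * k" v] by (simp add: F_def algebra_simps)
    \<comment> \<open>The factor 2s clears the halves and, since s^2 = 1, also the sign.\<close>
    then have "scale (2 * of_int s * (of_int s / 2 - of_int (s * k))) (F (k + 1)) +
        scale (2 * of_int s * (of_int s / 2 + of_int (s * k))) (F k) = 0"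
      by (simp only: scale_right_distrib[symmetric] scale_scale[symmetric] scale_zero_right)
    moreover have "2 * of_int s * (of_int s / 2 - of_int (s * k)) = (1 - 2 * of_int k :: complex)"
      "2 * of_int s * (of_int s / 2 + of_int (s * k)) = (1 + 2 * of_int k :: complex)"
      using s by (auto simp: algebra_simps)
    ultimately show ?thesis
      by (simp only: scale_minus_left eq_neg_iff_add_eq_0)
  qed
  have "F k = scale (1 - 2 * of_int k) (F 0)"
  proof (induction k rule: int_induct[where k = 0])
    case base
    show ?case by simp
  next
    case (step1 k)
    have "scale (1 - 2 * of_int k) (F (k + 1)) =
        scale (1 - 2 * of_int k) (scale (- (1 + 2 * of_int k)) (F 0))"
      by (subst step, subst step1.IH) (simp add: mult.commute)
    then have "F (k + 1) = scale (- (1 + 2 * of_int k)) (F 0)"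
      using of_int_odd_nonzero[of k] scale_left_imp_eq by blast
    then show ?case by (simp add: algebra_simps)
  next
    case (step2 k)
    have "scale (1 - 2 * of_int k) (F (k - 1)) = scale (1 - 2 * of_int (k - 1)) (F k)"
      using step[of "k - 1"] by simp
    also have "\<dots> = scale (1 - 2 * of_int k) (scale (1 - 2 * of_int (k - 1)) (F 0))"
      unfolding step2.IH by (rule scale_left_commute)
    finally show ?case
      using of_int_odd_nonzero scale_left_imp_eq by blast
  qed
  then show ?thesis by (simp add: F_def)
qed

text \<open>By \<open>G_G_sign\<close>, \<open>G a (G (s - a) v)\<close> is an odd multiple of
  \<open>G 0 (G s v)\<close>; a further \<open>G a\<close> kills it.\<close>

lemma G_G0_G_sign:
  assumes s: "s = 1 \<or> s = -1"
  shows "G a (G 0 (G s v)) = 0"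
proof -
  have "s * (s * a) = a" using s by auto
  then have "G a (G (s - a) v) = scale (1 - 2 * of_int (s * a)) (G 0 (G s v))"
    using G_G_sign[OF s, of "s * a" v] by (simp only:)
  then have "scale (1 - 2 * of_int (s * a)) (G a (G 0 (G s v))) = 0"
    by (metis G_square act_scale_right)
  then show ?thesis
    by (simp only: scale_eq_0_iff of_int_odd_nonzero simp_thms)
qed

section \<open>The common kernel of the G operators and their vanishing\<close>

definition G_kernel :: "'v set" where
  "G_kernel = {v. \<forall>a. G a v = 0}"

text \<open>[L_m, G_a] is a multiple of G_(m+a), which gives stability under L_m. The images of the
  even and odd components under \<open>G a\<close> have opposite parities, so they vanish
  separately.\<close>

lemma graded_submodule_G_kernel: "graded_submodule G_kernel"
proof (rule graded_submoduleI)
  show "subspace G_kernel" by (auto simp: subspace_def G_kernel_def)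
next
  fix b v assume v: "v \<in> G_kernel"
  show "act (Poly_Mapping.single b 1) v \<in> G_kernel"
  proof (cases b)
    case (BL m)
    have "G a (L m v) = 0" for a
      using L_G[of m a v] v by (simp add: G_kernel_def)
    then show ?thesis by (simp add: G_kernel_def BL)
  qed (use v in \<open>auto simp: G_kernel_def I_eq_0 H_eq_0\<close>)
next
  fix u w assume u: "u \<in> M 0" and w: "w \<in> M 1" and uw: "u + w \<in> G_kernel"
  have "G a u = 0 \<and> G a w = 0" for a
  proof -
    have "G a w \<in> M 0" "G a u \<in> M 1" "G a w + G a u = 0"
      using act_parity_basis[OF w, of "BG a"] act_parity_basis[OF u, of "BG a"] uw
      by (simp_all add: G_kernel_def add.commute)
    then show ?thesis using parity_independent by blast
  qed
  then show "u \<in> G_kernel \<and> w \<in> G_kernel" by (simp add: G_kernel_def)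
qed

text \<open>Bracketing G_0 G_1, G_0 G_(-1) and G_1 G_(-1) with L_(k-1), L_(k+1) and L_k gives three
  linear relations among three products \<open>e\<close>, \<open>p\<close>, \<open>q\<close> of
  total index \<open>k\<close>.\<close>

lemma G0_G_eq_0:
  assumes z1: "\<And>v. G 0 (G 1 v) = 0" and z2: "\<And>v. G 0 (G (- 1) v) = 0"
  shows "G 0 (G k v) = 0"
proof -
  define n where "n = (of_int k :: complex)"
  define e p q where "e = G 0 (G k v)" and "p = G 1 (G (k - 1) v)" and "q = G (k + 1) (G (- 1) v)"
  have double: "scale (2 * x) u + scale (2 * y) w = 0" if "scale x u + scale y w = 0" for x y u w
  proof -
    have "scale 2 (scale x u + scale y w) = 0" by (simp only: that scale_zero_right)
    then show ?thesis by (simp only: scale_right_distrib scale_scale)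
  qed
  have ep: "scale (n - 1) p = scale (n - 3) e"
  proof -
    have "2 * (of_int (k - 1) / 2 - of_int 0) = n - 1" "2 * (of_int (k - 1) / 2 - of_int 1) = n - 3"
      by (simp_all add: n_def field_simps)
    moreover have "G (k - 1 + 0) (G 1 v) = - p" "G 0 (G (k - 1 + 1) v) = e"
      using G_anticommute[of "k - 1" 1 v] by (simp_all add: p_def e_def)
    ultimately have "scale (n - 1) (- p) + scale (n - 3) e = 0"
      using double[OF G_G_zero_bracket[OF z1, of "k - 1" v]] by (simp only:)
    then show ?thesis by (simp only: scale_minus_right neg_eq_iff_add_eq_0[symmetric] minus_equation_iff minus_minus)
  qed
  have qe: "scale (n + 1) q = scale (- (n + 3)) e"
  proof -
    have "2 * (of_int (k + 1) / 2 - of_int 0) = n + 1" "2 * (of_int (k + 1) / 2 - of_int (- 1)) = n + 3"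
      by (simp_all add: n_def field_simps)
    moreover have "G (k + 1 + 0) (G (- 1) v) = q" "G 0 (G (k + 1 + - 1) v) = e"
      by (simp_all add: q_def e_def)
    ultimately have "scale (n + 1) q + scale (n + 3) e = 0"
      using double[OF G_G_zero_bracket[OF z2, of "k + 1" v]] by (simp only:)
    then show ?thesis by (simp only: scale_minus_left eq_neg_iff_add_eq_0)
  qed
  have qp: "scale (n - 2) q = scale (- (n + 2)) p"
  proof -
    have "2 * (of_int k / 2 - of_int 1) = n - 2" "2 * (of_int k / 2 - of_int (- 1)) = n + 2"
      by (simp_all add: n_def field_simps)
    moreover have "G (k + 1) (G (- 1) v) = q" "G 1 (G (k + - 1) v) = p"
      by (simp_all add: q_def p_def)
    ultimately have "scale (n - 2) q + scale (n + 2) p = 0"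
      using double[OF G_G_zero_bracket[OF G_G_uminus, of k 1 v]] by (simp only:)
    then show ?thesis by (simp only: scale_minus_left eq_neg_iff_add_eq_0)
  qed
  \<comment> \<open>Eliminating \<open>q\<close> and \<open>p\<close> by multiplication instead of
    division covers the \<open>n\<close> at which a coefficient vanishes; the two resulting cubics
    differ by the constant 12.\<close>
  have "scale ((n - 2) * (n - 1) * (n + 3)) e = scale (- ((n - 2) * (n - 1))) (scale (- (n + 3)) e)"
    by (simp only: scale_scale minus_mult_minus)
  also have "\<dots> = scale (- ((n - 2) * (n - 1))) (scale (n + 1) q)"
    by (simp only: qe)
  also have "\<dots> = scale (- ((n - 1) * (n + 1))) (scale (n - 2) q)"
    by (simp only: scale_scale) (simp only: mult_minus_left mult_minus_right mult_ac)
  also have "\<dots> = scale (- ((n - 1) * (n + 1))) (scale (- (n + 2)) p)"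
    by (simp only: qp)
  also have "\<dots> = scale ((n + 1) * (n + 2)) (scale (n - 1) p)"
    by (simp only: scale_scale minus_mult_minus) (simp only: mult_ac)
  also have "\<dots> = scale ((n + 1) * (n + 2) * (n - 3)) e"
    by (simp only: ep scale_scale)
  finally have "scale ((n - 2) * (n - 1) * (n + 3) - (n + 1) * (n + 2) * (n - 3)) e = 0"
    by (simp add: scale_left_diff_distrib)
  moreover have "(n - 2) * (n - 1) * (n + 3) - (n + 1) * (n + 2) * (n - 3) = 12"
    by (simp add: algebra_simps)
  ultimately show ?thesis by (simp add: e_def)
qed

lemma G_eq_0: "G m v = 0"
proof -
  have kernel_trivial: "w = 0" if "G_kernel = {0}" "\<And>a. G a w = 0" for w
    using that by (auto simp: G_kernel_def)
  consider "G_kernel = {0}" | "G_kernel = UNIV"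
    using irreducible_module graded_submodule_G_kernel by (auto simp: irreducible_module_def)
  then show ?thesis
  proof cases
    case 1
    have sign: "G 0 (G s w) = 0" if "s = 1 \<or> s = -1" for s w
      using kernel_trivial[OF 1] G_G0_G_sign[OF that] by blast
    have G0: "G 0 w = 0" for w
    proof (rule kernel_trivial[OF 1])
      show "G a (G 0 w) = 0" for a
        using G_anticommute[of a 0 w] G0_G_eq_0[OF sign sign, of a w] by simp
    qed
    show ?thesis
      \<comment> \<open>[L_m, G_0] = (m/2) G_m.\<close>
      using L_G[of m 0 v] by (cases "m = 0") (simp_all add: G0)
  next
    case 2
    then show ?thesis by (auto simp: G_kernel_def)
  qed
qed

section \<open>Restriction to the Virasoro algebra\<close>

lemma concentrated:
  obtains i where "M i = UNIV"
proof -
  have "graded_submodule (M 0)"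
  proof (rule graded_submoduleI)
    show "act (Poly_Mapping.single b 1) v \<in> M 0" if "v \<in> M 0" for b v
      using act_parity_basis[OF that, of b] subspace_0[OF subspace_part]
      by (cases b) (auto simp: G_eq_0 H_eq_0)
    show "u \<in> M 0 \<and> w \<in> M 0" if uw: "u \<in> M 0" "w \<in> M 1" "u + w \<in> M 0" for u w
      using uw subspace_diff[OF subspace_part uw(3,1)] by simp
  qed (rule subspace_part)
  then consider "M 0 = {0}" | "M 0 = UNIV"
    using irreducible_module by (auto simp: irreducible_module_def)
  then show thesis
  proof cases
    case 1
    have "v \<in> M 1" for v by (rule parity_decomposition[of v]) (use 1 in auto)
    then show thesis using that[of 1] by blast
  qed (rule that)
qed

lemma Lgen_in_vir: "Lgen n \<in> vir"
  unfolding vir_def by (auto intro: sW.span_base)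

lemma vir_subset_even: "vir \<subseteq> sW_part 0"
  unfolding vir_def sW_part_def by (rule sW.span_mono) auto

sublocale vir_module scale act
proof
  \<comment> \<open>Elements of \<open>vir\<close> are even, so the super sign is 1.\<close>
  fix x y v assume "x \<in> vir" "y \<in> vir"
  then show "act (bracket x y) v = act x (act y v) - act y (act x v)"
    using act_bracket[of x 0 y 0 v] vir_subset_even by (auto simp: super_sign_def)
qed (simp_all add: linear_act_right)

text \<open>The other generators act as zero, and one parity is the whole space, so the component of
  the other parity is zero and \<open>N\<close> is automatically graded.\<close>

lemma vir_submodule_trivial:
  assumes N: "vir_submodule N"
  shows "N = {0} \<or> N = UNIV"
proof -
  have sub: "subspace N" using N by (simp add: vir_submodule_def)
  obtain i where i: "M i = UNIV" by (rule concentrated)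
  have "graded_submodule N"
  proof (rule graded_submoduleI[OF sub])
    show "act (Poly_Mapping.single b 1) v \<in> N" if "v \<in> N" for b v
      using N that Lgen_in_vir subspace_0[OF sub]
      by (cases b) (auto simp: vir_submodule_def I_eq_0 G_eq_0 H_eq_0)
    show "u \<in> N \<and> w \<in> N" if uw: "u \<in> M 0" "w \<in> M 1" "u + w \<in> N" for u w
    proof (cases "i = 0")
      case True
      then have "w = 0" using parts_disjoint[of w] uw i by simp
      then show ?thesis using uw subspace_0[OF sub] by simp
    next
      case False
      then have "u = 0" using parts_disjoint[of u] uw i by simp
      then show ?thesis using uw subspace_0[OF sub] by simp
    qed
  qed
  then show ?thesis using irreducible_module by (auto simp: irreducible_module_def)
qed

lemma vir_intermediate_series: "vir_intermediate_series scale act"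
proof
  obtain i where i: "M i = UNIV" by (rule concentrated)
  \<comment> \<open>Weights are negated eigenvalues, hence the reindexing along negation.\<close>
  have eig: "eigenspace = (\<lambda>\<mu>. weight_space i (- \<mu>))"
    by (auto simp: eigenspace_def weight_space_def i)
  have "bij (uminus :: complex \<Rightarrow> complex)" by (rule bij_uminus)
  from internal_direct_sum_reindex[OF this weight_decomposition[of i]]
  show "internal_direct_sum eigenspace UNIV" by (simp add: eig i)
  show "\<exists>B. finite B \<and> span B = eigenspace \<mu>" for \<mu>
    unfolding eig by (rule finite_dim_weight_space)
  show "dim (eigenspace \<mu>) \<le> 1" for \<mu>
    unfolding eig by (rule dim_weight_space_le)
  \<comment> \<open>Two nonzero submodules would both be the whole space and could not meet in
    zero.\<close>
  show indecomposable
    using irreducible_module vir_submodule_trivial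
    unfolding indecomposable_def irreducible_module_def by fast
qed

end

theorem theorem3p2:
  fixes scale :: "complex \<Rightarrow> 'v::ab_group_add \<Rightarrow> 'v"
    and act :: "sW \<Rightarrow> 'v \<Rightarrow> 'v"
    and M :: "bit \<Rightarrow> 'v set"
  assumes "sW_intermediate_series scale act M"
  shows "vir_intermediate_series scale act \<and>
    (\<forall>k v. act (Igen k) v = 0 \<and> act (Ggen k) v = 0 \<and> act (Hgen k) v = 0)"
proof -
  interpret sW_intermediate_series scale act M by (rule assms)
  show ?thesis
    using vir_intermediate_series I_eq_0 G_eq_0 H_eq_0 by blast
qed

end
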